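(* Let $G=(V,E)$ be a finite connected graph with $|V|=n+1\geq 2$, and let $r\in V$. Then $$CC_r(G)=\sum_{\substack{x,y\in V\\ x\neq y}} \frac{p_r(x<y)}{p_{xy}},$$ where for $x\neq y$, $p_{xy}$ is the probability that simple random walk started at $x$ visits $y$ before returning to $x$, and $p_r(x<y)$ is the probability that simple random walk started at $r$ visits $x$ before it visits $y$ (visits at time $0$ count, so $p_r(r<y)=1$ for $y\neq r$ and $p_r(x<r)=0$ for $x\neq r$).
   Context: Simple random walk on $G$: at each step the walker moves from its current vertex to a uniformly random neighbour. Cover cost: run simple random walk from $r$ until every vertex has been visited (the cover tour). For $i\geq 1$, the cost of the $i$-th step is $1-\frac{k}{n}$, where $k$ is the number of distinct vertices other than $r$ visited at times $0,1,\dots,i-1$, and $n=|V|-1$. The cover cost $cc_r(G)$ is the expected total cost of all steps of the cover tour, and the (uppercase) Cover Cost is $CC_r(G):=n\,cc_r(G)$. *)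

theory Defs
  imports "HOL-Probability.Probability" "Graph_Theory.Digraph_Component"
begin

section \<open>Simple random walk\<close>

definition neighbours :: "('a, 'b) pre_digraph \<Rightarrow> 'a \<Rightarrow> 'a set" where
  "neighbours G v = {w. v \<rightarrow>\<^bsub>G\<^esub> w}"

text \<open>
  The walk is driven by an i.i.d. sequence of random maps: \<open>\<phi> !! t\<close> is uniformly distributed
  over all maps sending every vertex to one of its neighbours, that is, the values
  \<open>(\<phi> !! t) v\<close> for \<open>v \<in> verts G\<close> are independent, each a uniformly random neighbour of \<open>v\<close>.
  The walk started at \<open>r\<close> has \<open>X\<^sub>0 = r\<close> and moves from \<open>X\<^sub>t\<close> to \<open>(\<phi> !! t) X\<^sub>t\<close>. Lemma
  \<open>srw_path_prob\<close> below gives the finite-dimensional distributions.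
\<close>

definition random_step :: "('a, 'b) pre_digraph \<Rightarrow> ('a \<Rightarrow> 'a) measure" where
  "random_step G = uniform_count_measure (\<Pi>\<^sub>E v\<in>verts G. neighbours G v)"

primcorec walk :: "'a \<Rightarrow> ('a \<Rightarrow> 'a) stream \<Rightarrow> 'a stream" where
  "walk v \<phi> = v ## walk (shd \<phi> v) (stl \<phi>)"

text \<open>The law of simple random walk on \<open>G\<close> started at \<open>r\<close>, as a measure on trajectories.\<close>

definition srw :: "('a, 'b) pre_digraph \<Rightarrow> 'a \<Rightarrow> 'a stream measure" where
  "srw G r = distr (stream_space (random_step G)) (stream_space (count_space (verts G))) (walk r)"

lemma space_srw: "space (srw G r) = streams (verts G)"
  by (simp add: srw_def space_stream_space)

lemma sets_srw [measurable_cong]: "sets (srw G r) = sets (stream_space (count_space (verts G)))"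
  by (simp add: srw_def)

lemma space_random_step: "space (random_step G) = (\<Pi>\<^sub>E v\<in>verts G. neighbours G v)"
  by (simp add: random_step_def space_uniform_count_measure)

lemma sets_random_step: "sets (random_step G) = sets (count_space (\<Pi>\<^sub>E v\<in>verts G. neighbours G v))"
  by (simp add: random_step_def sets_uniform_count_measure)

context fin_digraph
begin

lemma neighbours_subset: "neighbours G v \<subseteq> verts G"
  unfolding neighbours_def arcs_ends_def arc_to_ends_def by auto

lemma finite_neighbours: "finite (neighbours G v)"
  using finite_subset[OF neighbours_subset finite_verts] .

lemma finite_step_maps: "finite (\<Pi>\<^sub>E v\<in>verts G. neighbours G v)"
  by (intro finite_PiE finite_verts finite_neighbours)

lemma measurable_walk:
  assumes "v \<in> verts G"
  shows "walk v \<in> measurable (stream_space (random_step G)) (stream_space (count_space (verts G)))"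
proof (rule measurable_stream_space2)
  let ?S = "\<Pi>\<^sub>E v\<in>verts G. neighbours G v"
  fix n
  show "(\<lambda>\<phi>. walk v \<phi> !! n) \<in> measurable (stream_space (random_step G)) (count_space (verts G))"
    using assms
  proof (induction n arbitrary: v)
    case (Suc n)
    have "(\<lambda>\<phi>. walk (f v) (stl \<phi>) !! n)
        \<in> measurable (stream_space (random_step G)) (count_space (verts G))" if "f \<in> ?S" for f
      using Suc that neighbours_subset
      by (intro measurable_compose[OF measurable_stl Suc.IH]) (auto dest!: PiE_mem)
    moreover have "shd \<in> measurable (stream_space (random_step G)) (count_space ?S)"
      using measurable_shd measurable_cong_sets[OF refl sets_random_step] by blast
    ultimately have "(\<lambda>\<phi>. walk (shd \<phi> v) (stl \<phi>) !! n)
        \<in> measurable (stream_space (random_step G)) (count_space (verts G))"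
      using countable_finite[OF finite_step_maps]
      by (rule measurable_compose_countable'[where f = "\<lambda>f \<phi>. walk (f v) (stl \<phi>) !! n"])
    then show ?case by simp
  qed simp
qed

end

locale random_walk_graph = fin_digraph +
  assumes no_isolated: "v \<in> verts G \<Longrightarrow> neighbours G v \<noteq> {}"
begin

lemma step_maps_nonempty: "(\<Pi>\<^sub>E v\<in>verts G. neighbours G v) \<noteq> {}"
  using no_isolated by (auto simp: PiE_eq_empty_iff)

lemma prob_space_random_step: "prob_space (random_step G)"
  unfolding random_step_def
  by (intro prob_space_uniform_count_measure finite_step_maps step_maps_nonempty)

lemma prob_space_srw:
  assumes "r \<in> verts G"
  shows "prob_space (srw G r)"
  unfolding srw_def using assms
  by (intro prob_space.prob_space_distr prob_space.prob_space_stream_space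
        prob_space_random_step measurable_walk)

lemma random_step_prob:
  assumes "v \<in> verts G"
  shows "measure (random_step G) {f \<in> space (random_step G). f v = w}
    = (if v \<rightarrow>\<^bsub>G\<^esub> w then 1 / card (neighbours G v) else 0)"
proof -
  let ?N = "neighbours G" and ?S = "\<Pi>\<^sub>E v\<in>verts G. neighbours G v"
  let ?A = "{f \<in> ?S. f v = w}"
  have "measure (random_step G) ?A = card ?A / card ?S"
    unfolding random_step_def by (intro measure_uniform_count_measure finite_step_maps) auto
  moreover have "card ?A = (if w \<in> ?N v then card (\<Pi>\<^sub>E u\<in>verts G - {v}. ?N u) else 0)"
  proof (cases "w \<in> ?N v")
    case True
    have A: "?A = (\<Pi>\<^sub>E u\<in>verts G. if u = v then {w} else ?N u)"
      using True assms by (auto simp: PiE_iff extensional_def split: if_splits)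
    show ?thesis
      using True assms finite_verts unfolding A
      by (simp add: card_PiE prod.remove[OF finite_verts assms])
  next
    case False
    then have "?A = {}" using assms by (auto dest: PiE_mem)
    with False show ?thesis by (simp only: card.empty if_False)
  qed
  moreover have "card ?S = card (?N v) * card (\<Pi>\<^sub>E u\<in>verts G - {v}. ?N u)"
    using finite_verts by (simp add: card_PiE prod.remove[OF finite_verts assms])
  moreover have "card ?S \<noteq> 0" using finite_step_maps step_maps_nonempty by simp
  ultimately show ?thesis
    unfolding space_random_step by (auto simp: neighbours_def[of G v])
qed

lemma srw_path_prob:
  assumes "x 0 \<in> verts G"
  shows "\<P>(X in srw G (x 0). \<forall>i\<le>n. X !! i = x i)
    = (\<Prod>i<n. if x i \<rightarrow>\<^bsub>G\<^esub> x (Suc i) then 1 / card (neighbours G (x i)) else 0)"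
proof -
  let ?R = "stream_space (random_step G)"
  let ?c = "\<lambda>u v. if u \<rightarrow>\<^bsub>G\<^esub> v then 1 / real (card (neighbours G u)) else 0"
  interpret R: prob_space "random_step G" by (rule prob_space_random_step)
  interpret RS: prob_space ?R by (rule R.prob_space_stream_space)
  have cylinder: "Measurable.pred (stream_space (count_space (verts G))) (\<lambda>X. \<forall>i\<le>n. X !! i = y i)"
    for y :: "nat \<Rightarrow> 'a" and n
  proof -
    have "Measurable.pred (stream_space (count_space (verts G))) (\<lambda>X. X !! i = y i)" for i
      by (rule measurable_compose[OF measurable_snth]) simp
    then have "Measurable.pred (stream_space (count_space (verts G))) (\<lambda>X. \<forall>i\<in>{..n}. X !! i = y i)"
      by (rule pred_intros_finite(3)[OF finite_atMost])
    then show ?thesis by (simp only: Ball_def atMost_iff)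
  qed
  have meas: "Measurable.pred ?R (\<lambda>\<phi>. \<forall>i\<le>n. walk (y 0) \<phi> !! i = y i)"
    if "y 0 \<in> verts G" for y n
    by (rule measurable_compose[OF measurable_walk[OF that] cylinder])
  have "\<P>(\<phi> in ?R. \<forall>i\<le>n. walk (x 0) \<phi> !! i = x i) = (\<Prod>i<n. ?c (x i) (x (Suc i)))"
    using assms
  proof (induction n arbitrary: x)
    case 0
    then show ?case by (simp add: RS.prob_space)
  next
    case (Suc n)
    let ?P = "\<P>(\<phi> in ?R. \<forall>i\<le>n. walk (x 1) \<phi> !! i = x (Suc i))"
    have all_Suc: "(\<forall>i\<le>Suc n. walk (x 0) (f ## \<phi>) !! i = x i) \<longleftrightarrow>
        f (x 0) = x 1 \<and> (\<forall>i\<le>n. walk (x 1) \<phi> !! i = x (Suc i))" for f \<phi>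
    proof -
      have "(\<forall>i\<le>Suc n. walk (x 0) (f ## \<phi>) !! i = x i) \<longleftrightarrow>
          (\<forall>i\<le>n. walk (f (x 0)) \<phi> !! i = x (Suc i))"
        unfolding less_Suc_eq_le[symmetric] All_less_Suc2[of "Suc n"] by simp
      also have "\<dots> \<longleftrightarrow> f (x 0) = x 1 \<and> (\<forall>i\<le>n. walk (x 1) \<phi> !! i = x (Suc i))"
      proof (cases "f (x 0) = x 1")
        case False
        then have "walk (f (x 0)) \<phi> !! 0 \<noteq> x (Suc 0)" by simp
        with False show ?thesis by blast
      qed simp
      finally show ?thesis .
    qed
    have "ennreal \<P>(\<phi> in ?R. \<forall>i\<le>Suc n. walk (x 0) \<phi> !! i = x i) =
        (\<integral>\<^sup>+f. \<P>(\<phi> in ?R. \<forall>i\<le>Suc n. walk (x 0) (f ## \<phi>) !! i = x i) \<partial>random_step G)"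
      by (rule R.prob_stream_space[where P = "\<lambda>\<phi>. \<forall>i\<le>Suc n. walk (x 0) \<phi> !! i = x i"])
        (use meas[of x "Suc n"] Suc.prems in \<open>simp only: pred_def\<close>)
    also have "\<dots> = (\<integral>\<^sup>+f. ennreal ?P * indicator {f \<in> space (random_step G). f (x 0) = x 1} f
        \<partial>random_step G)"
      unfolding all_Suc by (intro nn_integral_cong) (auto simp: indicator_def)
    also have "\<dots> = ennreal ?P * ennreal (R.prob {f \<in> space (random_step G). f (x 0) = x 1})"
      by (subst nn_integral_cmult_indicator)
        (auto simp: sets_random_step space_random_step R.emeasure_eq_measure)
    also have "R.prob {f \<in> space (random_step G). f (x 0) = x 1} = ?c (x 0) (x 1)"
      by (rule random_step_prob) (rule Suc.prems)
    also have "ennreal ?P * ennreal (?c (x 0) (x 1)) = ennreal (?P * ?c (x 0) (x 1))"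
      by (rule ennreal_mult[symmetric]) auto
    finally have "\<P>(\<phi> in ?R. \<forall>i\<le>Suc n. walk (x 0) \<phi> !! i = x i) = ?P * ?c (x 0) (x 1)"
      by (subst (asm) ennreal_inj) auto
    also have "\<dots> = (\<Prod>i<n. ?c (x (Suc i)) (x (Suc (Suc i)))) * ?c (x 0) (x 1)"
    proof (cases "x 0 \<rightarrow>\<^bsub>G\<^esub> x 1")
      case True
      then have "x 1 \<in> verts G" using neighbours_subset[of "x 0"] by (auto simp: neighbours_def)
      then show ?thesis using Suc.IH[of "\<lambda>i. x (Suc i)"] by simp
    qed simp
    also have "\<dots> = (\<Prod>i<Suc n. ?c (x i) (x (Suc i)))"
      by (subst prod.lessThan_Suc_shift) (simp add: mult.commute)
    finally show ?case .
  qed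
  moreover have "\<P>(X in srw G (x 0). \<forall>i\<le>n. X !! i = x i) =
      \<P>(\<phi> in ?R. \<forall>i\<le>n. walk (x 0) \<phi> !! i = x i)"
  proof -
    let ?A = "{X \<in> space (srw G (x 0)). \<forall>i\<le>n. X !! i = x i}"
    have "?A \<in> sets (stream_space (count_space (verts G)))"
      using cylinder[of n x] by (simp only: pred_def space_stream_space space_count_space space_srw)
    then have "measure (srw G (x 0)) ?A = measure ?R (walk (x 0) -` ?A \<inter> space ?R)"
      unfolding srw_def by (rule measure_distr[OF measurable_walk[OF assms]])
    also have "walk (x 0) -` ?A \<inter> space ?R = {\<phi> \<in> space ?R. \<forall>i\<le>n. walk (x 0) \<phi> !! i = x i}"
      using measurable_space[OF measurable_walk[OF assms]]
      unfolding space_stream_space[of "count_space (verts G)"] space_count_space space_srw by blast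
    finally show ?thesis .
  qed
  ultimately show ?thesis by (simp only:)
qed

end

lemma connected_graph_random_walk:
  assumes "Digraph.graph G" and "Digraph_Component.connected G" and "card (verts G) \<ge> 2"
  shows "random_walk_graph G"
proof -
  interpret graph G by fact
  show ?thesis
  proof
    fix v assume v: "v \<in> verts G"
    have "\<not> verts G \<subseteq> {v}"
      using assms(3) card_mono[of "{v}" "verts G"] by auto
    then obtain u where u: "u \<in> verts G" "u \<noteq> v" by blast
    have "strongly_connected G"
      using assms(2) sym_arcs by (intro symmetric_connected_imp_strongly_connected)
    then have "v \<rightarrow>\<^sup>*\<^bsub>G\<^esub> u" using u v by (auto simp: strongly_connected_def)
    then obtain w where "v \<rightarrow>\<^bsub>G\<^esub> w"
      using u(2) by (cases rule: converse_reachable_cases) auto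
    then show "neighbours G v \<noteq> {}" by (auto simp: neighbours_def)
  qed
qed

section \<open>Hitting probabilities\<close>

text \<open>\<open>hit_before_return G x y\<close> is \<open>p\<^sub>x\<^sub>y\<close> (for \<open>x \<noteq> y\<close>): started at \<open>x\<close>, the walk visits \<open>y\<close> before
  returning to \<open>x\<close> at a positive time.\<close>

definition hit_before_return :: "('a, 'b) pre_digraph \<Rightarrow> 'a \<Rightarrow> 'a \<Rightarrow> real" where
  "hit_before_return G x y = \<P>(X in srw G x. \<exists>t\<ge>1. X !! t = y \<and> (\<forall>s\<in>{1..<t}. X !! s \<noteq> x))"

text \<open>\<open>visits_before G r x y\<close> is \<open>p\<^sub>r(x < y)\<close> (for \<open>x \<noteq> y\<close>); visits at time \<open>0\<close> count.\<close>

definition visits_before :: "('a, 'b) pre_digraph \<Rightarrow> 'a \<Rightarrow> 'a \<Rightarrow> 'a \<Rightarrow> real" where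
  "visits_before G r x y = \<P>(X in srw G r. \<exists>t. X !! t = x \<and> (\<forall>s<t. X !! s \<noteq> y))"

section \<open>Cover cost\<close>

definition cover_time :: "('a, 'b) pre_digraph \<Rightarrow> 'a stream \<Rightarrow> enat" where
  "cover_time G X = Inf {enat t | t. verts G \<subseteq> (!!) X ` {..t}}"

text \<open>The cost of the \<open>i\<close>-th step, \<open>i \<ge> 1\<close>; the denominator is \<open>n = |V| - 1\<close>.\<close>

definition step_cost :: "('a, 'b) pre_digraph \<Rightarrow> 'a \<Rightarrow> 'a stream \<Rightarrow> nat \<Rightarrow> real" where
  "step_cost G r X i = 1 - real (card ((!!) X ` {..<i} - {r})) / (real (card (verts G)) - 1)"

text \<open>
  Costs of steps are nonnegative on trajectories in \<open>G\<close>, so the total cost of the cover tour is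
  taken in \<open>ennreal\<close>; finiteness of its expectation is then part of any statement
  equating it with a real number.
\<close>

definition tour_cost :: "('a, 'b) pre_digraph \<Rightarrow> 'a \<Rightarrow> 'a stream \<Rightarrow> ennreal" where
  "tour_cost G r X =
     (\<Sum>i. if 1 \<le> i \<and> enat i \<le> cover_time G X then ennreal (step_cost G r X i) else 0)"

definition cover_cost :: "('a, 'b) pre_digraph \<Rightarrow> 'a \<Rightarrow> ennreal" where
  "cover_cost G r = (\<integral>\<^sup>+X. tour_cost G r X \<partial>srw G r)"

definition Cover_Cost :: "('a, 'b) pre_digraph \<Rightarrow> 'a \<Rightarrow> ennreal" where
  "Cover_Cost G r = of_nat (card (verts G) - 1) * cover_cost G r"

end

theory Submission
  imports Defs
begin

text \<open>
  Multiplied by \<open>n\<close>, the cost of a step counts the vertices \<open>y \<noteq> r\<close> not visited so far, so the cover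
  cost is the sum over \<open>y \<noteq> r\<close> of the expected hitting times of \<open>y\<close>. Each hitting time is in turn
  the sum over \<open>x \<noteq> y\<close> of the number of visits to \<open>x\<close> before \<open>y\<close>. If \<open>g\<close> denotes the expected number
  of these visits, then decomposing the event that \<open>x\<close> is visited before \<open>y\<close> at the last visit to \<open>x\<close>
  before \<open>y\<close> gives \<open>p\<^sub>r(x < y) = g p\<^sub>x\<^sub>y\<close> by the Markov property at a deterministic time. Taking \<open>r = x\<close>
  shows \<open>p\<^sub>x\<^sub>y \<noteq> 0\<close>.
\<close>

section \<open>Measurability, first-step analysis and the Markov property\<close>

lemma pred_snth_eq [measurable]:
  "Measurable.pred (stream_space (count_space A)) (\<lambda>X. X !! n = x)"
  by (rule measurable_compose[OF measurable_snth]) simp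

context random_walk_graph
begin

abbreviation paths where "paths \<equiv> stream_space (count_space (verts G))"

lemma sets_srw_Collect:
  assumes "Measurable.pred paths P"
  shows "{X \<in> space (srw G r). P X} \<in> sets (srw G r)"
  using assms by (simp add: pred_def space_srw sets_srw space_stream_space)

lemma prob_srw_eq:
  assumes "r \<in> verts G" and "Measurable.pred paths P"
  shows "\<P>(X in srw G r. P X) = \<P>(\<phi> in stream_space (random_step G). P (walk r \<phi>))"
proof -
  have "\<P>(X in srw G r. P X) = measure (stream_space (random_step G))
      (walk r -` {X \<in> space (srw G r). P X} \<inter> space (stream_space (random_step G)))"
    using sets_srw_Collect[OF assms(2), of r] unfolding srw_def
    by (intro measure_distr measurable_walk assms(1)) simp
  also have "walk r -` {X \<in> space (srw G r). P X} \<inter> space (stream_space (random_step G)) =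
      {\<phi> \<in> space (stream_space (random_step G)). P (walk r \<phi>)}"
    using measurable_space[OF measurable_walk[OF assms(1)]]
    by (auto simp: space_srw space_stream_space)
  finally show ?thesis .
qed

lemma step_map_in_verts: "f \<in> (\<Pi>\<^sub>E v\<in>verts G. neighbours G v) \<Longrightarrow> v \<in> verts G \<Longrightarrow> f v \<in> verts G"
  using neighbours_subset by (auto dest!: PiE_mem)

text \<open>First-step analysis. Averaging over whole step maps rather than neighbours of
  \<open>r\<close> keeps the average uniform and free of degrees.\<close>

lemma prob_srw_step:
  assumes r: "r \<in> verts G" and P: "Measurable.pred paths P"
  shows "\<P>(X in srw G r. P X) =
    (\<Sum>f\<in>(\<Pi>\<^sub>E v\<in>verts G. neighbours G v). \<P>(X in srw G (f r). P (r ## X))) /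
      card (\<Pi>\<^sub>E v\<in>verts G. neighbours G v)"
proof -
  let ?R = "stream_space (random_step G)" and ?S = "\<Pi>\<^sub>E v\<in>verts G. neighbours G v"
  interpret R: prob_space "random_step G" by (rule prob_space_random_step)
  note [measurable] = P
  have "Measurable.pred ?R (\<lambda>\<phi>. P (walk r \<phi>))"
    by (rule measurable_compose[OF measurable_walk[OF r] P])
  then have "ennreal \<P>(\<phi> in ?R. P (walk r \<phi>)) =
      (\<integral>\<^sup>+f. \<P>(\<phi> in ?R. P (walk r (f ## \<phi>))) \<partial>random_step G)"
    by (intro R.prob_stream_space[where P = "\<lambda>\<phi>. P (walk r \<phi>)"]) (simp only: pred_def)
  also have "\<dots> = (\<integral>\<^sup>+f. \<P>(X in srw G (f r). P (r ## X)) \<partial>random_step G)"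
  proof (intro nn_integral_cong arg_cong[where f = ennreal])
    fix f assume "f \<in> space (random_step G)"
    then have fr: "f r \<in> verts G"
      using r step_map_in_verts unfolding space_random_step by blast
    have "walk r (f ## \<phi>) = r ## walk (f r) \<phi>" for \<phi>
      by (subst walk.code) simp
    moreover have "Measurable.pred paths (\<lambda>X. P (r ## X))"
      using r by (auto intro!: measurable_compose[OF _ P] measurable_Stream measurable_ident_sets)
    ultimately show "\<P>(\<phi> in ?R. P (walk r (f ## \<phi>))) = \<P>(X in srw G (f r). P (r ## X))"
      using prob_srw_eq[OF fr] by simp
  qed
  also have "\<dots> = ennreal ((\<Sum>f\<in>?S. \<P>(X in srw G (f r). P (r ## X))) / card ?S)"
    unfolding random_step_def uniform_count_measure_def
    using finite_step_maps
    by (subst nn_integral_point_measure_finite)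
      (auto simp flip: ennreal_mult sum_ennreal simp: sum_divide_distrib intro!: sum_nonneg)
  finally show ?thesis
    using prob_srw_eq[OF r P] by (subst (asm) ennreal_inj) (auto intro!: sum_nonneg divide_nonneg_nonneg)
qed

text \<open>The sample space contains every vertex stream, so the starting point is only almost
  sure; for \<open>n = 0\<close> the path probability is an empty product.\<close>

lemma AE_srw_start:
  assumes "r \<in> verts G"
  shows "AE X in srw G r. X !! 0 = r"
proof -
  interpret prob_space "srw G r" by (rule prob_space_srw) fact
  have "\<P>(X in srw G r. X !! 0 = r) = 1"
    using srw_path_prob[of "\<lambda>_. r" 0] assms by simp
  then show ?thesis
    by (subst (asm) prob_Collect_eq_1) (auto intro: sets_srw_Collect)
qed

text \<open>Induction on \<open>n\<close> with the start arbitrary: conditioning on the first map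
  shortens both events by one step.\<close>

lemma srw_Markov:
  assumes r: "r \<in> verts G" and B[measurable]: "Measurable.pred paths B"
  shows "\<P>(X in srw G r. (\<forall>s\<le>n. X !! s \<noteq> y) \<and> X !! n = x \<and> B (sdrop n X)) =
    \<P>(X in srw G r. (\<forall>s\<le>n. X !! s \<noteq> y) \<and> X !! n = x) * \<P>(X in srw G x. B X)"
  using r
proof (induction n arbitrary: r)
  case 0
  interpret prob_space "srw G r" by (rule prob_space_srw) fact
  \<comment> \<open>Used with \<open>B' = B\<close> for the left-hand side and with the trivial
    event for the first factor on the right; the same device recurs in the step case.\<close>
  have *: "\<P>(X in srw G r. (\<forall>s\<le>0. X !! s \<noteq> y) \<and> X !! 0 = x \<and> B' X) =
     (if r \<noteq> y \<and> r = x then \<P>(X in srw G r. B' X) else 0)" if "Measurable.pred paths B'" for B'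
  proof -
    note [measurable] = that
    have "\<P>(X in srw G r. (\<forall>s\<le>0. X !! s \<noteq> y) \<and> X !! 0 = x \<and> B' X) =
       \<P>(X in srw G r. r \<noteq> y \<and> r = x \<and> B' X)"
      using AE_srw_start[OF 0]
      by (intro prob_eq_AE sets_srw_Collect) (auto elim!: eventually_mono)
    then show ?thesis by auto
  qed
  show ?case
    using *[OF B] *[of "\<lambda>_. True"] prob_space by auto
next
  case (Suc n)
  let ?S = "\<Pi>\<^sub>E v\<in>verts G. neighbours G v"
  have all: "(\<forall>s\<le>Suc n. (r ## X) !! s \<noteq> y) \<longleftrightarrow> r \<noteq> y \<and> (\<forall>s\<le>n. X !! s \<noteq> y)" for X
    unfolding less_Suc_eq_le[symmetric] All_less_Suc2[of "Suc n"] by simp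
  have step: "\<P>(X in srw G r. (\<forall>s\<le>Suc n. X !! s \<noteq> y) \<and> X !! Suc n = x \<and> B' (sdrop (Suc n) X)) =
    (\<Sum>f\<in>?S. \<P>(X in srw G (f r). r \<noteq> y \<and> (\<forall>s\<le>n. X !! s \<noteq> y) \<and> X !! n = x \<and> B' (sdrop n X)))
      / card ?S"
    if [measurable]: "Measurable.pred paths B'" for B'
    by (subst prob_srw_step[OF Suc.prems]) (measurable, simp add: all)
  show ?case
  proof (cases "r = y")
    case True
    then show ?thesis
      using step[OF B] step[of "\<lambda>_. True"] by simp
  next
    case False
    then show ?thesis
      using step[OF B] step[of "\<lambda>_. True"] Suc.IH step_map_in_verts[OF _ Suc.prems]
      by (simp add: sum_distrib_right)
  qed
qed

section \<open>Almost sure hitting of every vertex\<close>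

text \<open>The probability of never visiting \<open>y\<close> is harmonic off \<open>y\<close> and vanishes at \<open>y\<close>, hence is \<open>0\<close> by the
  maximum principle.\<close>

lemma AE_srw_visits:
  assumes sc: "strongly_connected G" and r: "r \<in> verts G" and y: "y \<in> verts G"
  shows "AE X in srw G r. \<exists>t. X !! t = y"
proof -
  let ?S = "\<Pi>\<^sub>E v\<in>verts G. neighbours G v"
  define p where "p v = \<P>(X in srw G v. \<forall>t. X !! t \<noteq> y)" for v
  have avoid: "Measurable.pred paths (\<lambda>X. \<forall>t. X !! t \<noteq> y)"
    by (intro pred_intros_countable pred_intros_logic pred_snth_eq)
  define M where "M = Max (p ` verts G)"
  have le_M: "p v \<le> M" if "v \<in> verts G" for v
    unfolding M_def using that by simp
  have "M \<in> p ` verts G"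
    using r unfolding M_def by (intro Max_in) auto
  then obtain v where v: "v \<in> verts G" "p v = M" by blast
  have p_y: "p y = 0"
  proof -
    interpret prob_space "srw G y" by (rule prob_space_srw) fact
    have "p y = \<P>(X in srw G y. False)"
      unfolding p_def using AE_srw_start[OF y]
      by (intro prob_eq_AE sets_srw_Collect) (auto elim!: eventually_mono intro!: exI[of _ 0])
    then show ?thesis by simp
  qed
  have step: "p u = (\<Sum>f\<in>?S. p (f u)) / card ?S" if u: "u \<in> verts G" "u \<noteq> y" for u
  proof -
    have "(\<forall>t. (u ## X) !! t \<noteq> y) \<longleftrightarrow> (\<forall>t. X !! t \<noteq> y)" for X
      using u(2) by (auto simp: Stream_snth split: nat.splits)
    then show ?thesis
      unfolding p_def by (simp only: prob_srw_step[OF u(1) avoid])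
  qed
  have card_S: "card ?S \<noteq> 0"
    using finite_step_maps step_maps_nonempty by simp
  have propagate: "p w = M" if u: "u \<in> verts G" "u \<noteq> y" "p u = M" and uw: "u \<rightarrow>\<^bsub>G\<^esub> w" for u w
  proof -
    \<comment> \<open>An average of values at most \<open>M\<close> equals \<open>M\<close> only if
      every value does; redirecting any step map at \<open>u\<close> to \<open>w\<close> then puts
      \<open>p w\<close> among these values.\<close>
    have "(\<Sum>f\<in>?S. M - p (f u)) = 0"
      using step[OF u(1,2)] u(3) card_S by (simp add: sum_subtractf field_simps)
    then have eq: "\<forall>f\<in>?S. p (f u) = M"
      using le_M step_map_in_verts[OF _ u(1)] finite_step_maps
      by (subst (asm) sum_nonneg_eq_0_iff) auto
    obtain f where "f \<in> ?S"
      using step_maps_nonempty by blast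
    then have "f(u := w) \<in> ?S"
      using u(1) uw by (auto simp: PiE_iff extensional_def neighbours_def)
    with eq show ?thesis by fastforce
  qed
  have "M = 0"
  proof (rule ccontr)
    assume "M \<noteq> 0"
    \<comment> \<open>The value \<open>M\<close> spreads along a path from the maximiser
      \<open>v\<close>; it can be passed on at \<open>u\<close> because \<open>p u = M\<close> is
      nonzero, so \<open>u\<close> is not \<open>y\<close>.\<close>
    have "v \<rightarrow>\<^sup>*\<^bsub>G\<^esub> y"
      using sc v y by (auto simp: strongly_connected_def)
    then have "p y = M"
    proof (induction rule: reachable_induct)
      case base
      show ?case by fact
    next
      case (step u w)
      then show ?case
        using propagate[of u w] p_y \<open>M \<noteq> 0\<close> by (auto dest: reachable_in_verts)
    qed
    with p_y \<open>M \<noteq> 0\<close> show False by simp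
  qed
  interpret prob_space "srw G r" by (rule prob_space_srw) fact
  have "p r = 0"
    using le_M[OF r] \<open>M = 0\<close> by (simp add: p_def measure_le_0_iff)
  then have "AE X in srw G r. \<not> (\<forall>t. X !! t \<noteq> y)"
    unfolding p_def by (subst (asm) prob_Collect_eq_0) (auto intro!: sets_srw_Collect)
  then show ?thesis by simp
qed

section \<open>Last-exit decomposition and the Green function\<close>

text \<open>The last-visit events for different \<open>n\<close> are disjoint, and since
  \<open>y\<close> is hit almost surely, their union is, up to a null set, the event that
  \<open>x\<close> comes before \<open>y\<close>.\<close>

lemma visits_before_sums:
  assumes sc: "strongly_connected G"
    and r: "r \<in> verts G" and y: "y \<in> verts G" and "x \<noteq> y"
  shows "(\<lambda>n. \<P>(X in srw G r. (\<forall>s\<le>n. X !! s \<noteq> y) \<and> X !! n = x) * hit_before_return G x y)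
    sums visits_before G r x y"
proof -
  interpret prob_space "srw G r" by (rule prob_space_srw) fact
  define H where "H X \<longleftrightarrow> (\<exists>t\<ge>1. X !! t = y \<and> (\<forall>s\<in>{1..<t}. X !! s \<noteq> x))" for X
  have H[measurable]: "Measurable.pred paths H"
    unfolding H_def by measurable
  \<comment> \<open>time \<open>n\<close> is the last visit to \<open>x\<close> before the first visit to \<open>y\<close>\<close>
  define last where "last n X \<longleftrightarrow> (\<forall>s\<le>n. X !! s \<noteq> y) \<and> X !! n = x \<and> H (sdrop n X)" for n X
  have last_measurable: "Measurable.pred paths (last n)" for n
    unfolding last_def by measurable
  have H_sdrop: "H (sdrop n X) \<longleftrightarrow> (\<exists>t>n. X !! t = y \<and> (\<forall>s\<in>{n<..<t}. X !! s \<noteq> x))" for n X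
  proof
    assume "H (sdrop n X)"
    then obtain t where t: "t \<ge> 1" "X !! (n + t) = y" "\<forall>s\<in>{1..<t}. X !! (n + s) \<noteq> x"
      by (auto simp: H_def sdrop_snth)
    have "X !! s \<noteq> x" if "s \<in> {n<..<n + t}" for s
      using t(3)[rule_format, of "s - n"] that by (simp add: less_diff_conv2 Suc_le_eq)
    with t show "\<exists>t>n. X !! t = y \<and> (\<forall>s\<in>{n<..<t}. X !! s \<noteq> x)"
      by (intro exI[of _ "n + t"]) auto
  next
    assume "\<exists>t>n. X !! t = y \<and> (\<forall>s\<in>{n<..<t}. X !! s \<noteq> x)"
    then obtain t where "t > n" "X !! t = y" "\<forall>s\<in>{n<..<t}. X !! s \<noteq> x" by auto
    then show "H (sdrop n X)"
      unfolding H_def by (intro exI[of _ "t - n"]) (auto simp: sdrop_snth)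
  qed
  have not_both: False if "last m X" "last n X" "m < n" for m n X
  proof -
    from that(1) obtain t where "X !! t = y" "\<forall>s\<in>{m<..<t}. X !! s \<noteq> x"
      unfolding last_def H_sdrop by auto
    \<comment> \<open>If \<open>t\<close> is at most \<open>n\<close>, \<open>last n\<close> forbids
      the visit to \<open>y\<close> at \<open>t\<close>; otherwise the visit to \<open>x\<close> at
      \<open>n\<close> lies strictly between \<open>m\<close> and \<open>t\<close>.\<close>
    with that(2,3) show False
      unfolding last_def by (cases "t \<le> n") auto
  qed
  \<comment> \<open>The converse needs a visit to \<open>y\<close>: each \<open>last n\<close>
    entails one, whereas \<open>x\<close> may be seen before a \<open>y\<close> that never
    comes.\<close>
  have last_iff: "(\<exists>n. last n X) \<longleftrightarrow> (\<exists>t. X !! t = x \<and> (\<forall>s<t. X !! s \<noteq> y))"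
    if hit: "\<exists>t. X !! t = y" for X
  proof
    assume "\<exists>n. last n X"
    then show "\<exists>t. X !! t = x \<and> (\<forall>s<t. X !! s \<noteq> y)"
      unfolding last_def by (auto dest: less_imp_le)
  next
    define T where "T = (LEAST t. X !! t = y)"
    have T: "X !! T = y" "\<And>s. s < T \<Longrightarrow> X !! s \<noteq> y"
      unfolding T_def using hit by (auto intro: LeastI_ex dest: not_less_Least)
    assume "\<exists>t. X !! t = x \<and> (\<forall>s<t. X !! s \<noteq> y)"
    then obtain t where t: "X !! t = x" "\<forall>s<t. X !! s \<noteq> y" by auto
    have "t < T"
      using t T(1) \<open>x \<noteq> y\<close> by (metis linorder_neqE_nat)
    \<comment> \<open>Finite because it is cut off at the first hitting time \<open>T\<close> of
      \<open>y\<close>; its maximum is the last visit to \<open>x\<close> before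
      \<open>T\<close>.\<close>
    define A where "A = {n. n < T \<and> X !! n = x}"
    have in_A: "s \<in> A \<longleftrightarrow> s < T \<and> X !! s = x" for s
      by (simp add: A_def)
    have A: "finite A" "t \<in> A"
      using t \<open>t < T\<close> by (auto simp: A_def)
    then have "Max A \<in> A" by (intro Max_in) auto
    moreover have "X !! s \<noteq> x" if "Max A < s" "s < T" for s
      using that Max_ge[OF A(1), of s] by (auto simp: in_A)
    ultimately have "last (Max A) X"
      using T unfolding last_def H_sdrop in_A by (auto intro!: exI[of _ T])
    then show "\<exists>n. last n X" ..
  qed
  have "(\<lambda>n. \<P>(X in srw G r. last n X)) sums prob (\<Union>n. {X \<in> space (srw G r). last n X})"
    using sets_srw_Collect[OF last_measurable] not_both
    by (intro finite_measure_UNION) (auto simp: disjoint_family_on_def linorder_neq_iff)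
  also have "prob (\<Union>n. {X \<in> space (srw G r). last n X}) = \<P>(X in srw G r. \<exists>n. last n X)"
    by (intro arg_cong[where f = prob]) auto
  also have "\<dots> = visits_before G r x y"
    unfolding visits_before_def
  proof (intro prob_eq_AE sets_srw_Collect)
    show "AE X in srw G r. (\<exists>n. last n X) \<longleftrightarrow> (\<exists>t. X !! t = x \<and> (\<forall>s<t. X !! s \<noteq> y))"
      using AE_srw_visits[OF sc r y] by eventually_elim (rule last_iff)
  qed (intro pred_intros_countable last_measurable, measurable)
  finally show ?thesis
    unfolding last_def by (simp only: srw_Markov[OF r H]) (simp only: H_def hit_before_return_def)
qed

text \<open>The first value normalises the last-exit series started at \<open>x\<close>; the second
  makes the terms with \<open>y = r\<close> vanish in the final sum.\<close>

lemma visits_before_start: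
  assumes "x \<in> verts G" and "x \<noteq> y"
  shows "visits_before G x x y = 1" and "visits_before G x y x = 0"
proof -
  interpret prob_space "srw G x" by (rule prob_space_srw) fact
  have "visits_before G x x y = \<P>(X in srw G x. True)"
    unfolding visits_before_def using AE_srw_start[OF assms(1)]
    by (intro prob_eq_AE sets_srw_Collect) (auto elim!: eventually_mono intro!: exI[of _ 0])
  then show "visits_before G x x y = 1" using prob_space by simp
  have "\<not> (X !! t = y \<and> (\<forall>s<t. X !! s \<noteq> x))" if "X !! 0 = x" for X t
    using that assms(2) by (cases t) auto
  then have "visits_before G x y x = \<P>(X in srw G x. False)"
    unfolding visits_before_def using AE_srw_start[OF assms(1)]
    by (intro prob_eq_AE sets_srw_Collect) (auto elim!: eventually_mono)
  then show "visits_before G x y x = 0" by simp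
qed

text \<open>The Green function of the walk killed at \<open>y\<close>. If
  \<open>hit_before_return G x y\<close> were \<open>0\<close>, the last-exit series started at
  \<open>x\<close> would vanish, but its sum is \<open>1\<close>.\<close>

lemma sums_Green_function:
  assumes sc: "strongly_connected G"
    and r: "r \<in> verts G" and x: "x \<in> verts G" and y: "y \<in> verts G" and "x \<noteq> y"
  shows "(\<lambda>n. \<P>(X in srw G r. (\<forall>s\<le>n. X !! s \<noteq> y) \<and> X !! n = x))
    sums (visits_before G r x y / hit_before_return G x y)"
proof -
  have "hit_before_return G x y \<noteq> 0"
    using visits_before_sums[OF sc x y \<open>x \<noteq> y\<close>] visits_before_start(1)[OF x \<open>x \<noteq> y\<close>]
      sums_unique2[OF sums_zero, of "1 :: real"] by auto
  then show ?thesis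
    using sums_divide[OF visits_before_sums[OF sc r y \<open>x \<noteq> y\<close>], of "hit_before_return G x y"] by simp
qed

section \<open>Step costs and exchange of summation with expectation\<close>

text \<open>Step \<open>Suc i\<close> is priced by the vertices seen up to time \<open>i\<close>.
  Each \<open>y\<close> still unvisited then is counted once, because only the current position
  \<open>x = X !! i\<close> contributes.\<close>

lemma step_cost_eq:
  assumes X: "X \<in> streams (verts G)" and r: "r \<in> verts G" and card: "card (verts G) \<ge> 2"
  shows "of_nat (card (verts G) - 1) *
      (if enat (Suc i) \<le> cover_time G X then ennreal (step_cost G r X (Suc i)) else 0) =
    (\<Sum>y\<in>verts G - {r}. \<Sum>x\<in>verts G - {y}.
      indicator {X \<in> space (srw G r). (\<forall>s\<le>i. X !! s \<noteq> y) \<and> X !! i = x} X)" (is "?L = ?R")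
proof -
  let ?V = "(!!) X ` {..i}"
  have sub: "?V \<subseteq> verts G"
    using X by (auto simp: streams_iff_snth)
  have "?R = (\<Sum>y\<in>verts G - {r}. of_bool (y \<notin> ?V))"
  proof (intro sum.cong refl)
    fix y assume "y \<in> verts G - {r}"
    have "(\<Sum>x\<in>verts G - {y}. indicator {X \<in> space (srw G r). (\<forall>s\<le>i. X !! s \<noteq> y) \<and> X !! i = x} X) =
        (\<Sum>x\<in>verts G - {y}. if X !! i = x then of_bool (y \<notin> ?V) else (0 :: ennreal))"
      using X by (intro sum.cong refl) (auto simp: indicator_def space_srw)
    also have "\<dots> = of_bool (y \<notin> ?V)"
      using sub by (subst sum.delta') auto
    finally show "(\<Sum>x\<in>verts G - {y}.
        indicator {X \<in> space (srw G r). (\<forall>s\<le>i. X !! s \<noteq> y) \<and> X !! i = x} X) =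
        (of_bool (y \<notin> ?V) :: ennreal)" .
  qed
  also have "\<dots> = of_nat (card (verts G - {r} - ?V))"
    by (simp add: of_bool_def sum.If_cases set_diff_eq Int_def conj_ac)
  also have "\<dots> = ?L"
  proof (cases "enat (Suc i) \<le> cover_time G X")
    case True
    have "verts G - {r} - ?V = (verts G - {r}) - (?V - {r})" by auto
    then have "card (verts G - {r} - ?V) = card (verts G) - 1 - card (?V - {r})"
      using sub r by (simp add: card_Diff_subset Diff_mono)
    \<comment> \<open>This bound keeps the natural-number subtraction from truncating.\<close>
    moreover have "card (?V - {r}) \<le> card (verts G) - 1"
      using sub r card_mono[of "verts G - {r}" "?V - {r}"] by (auto simp: Diff_mono)
    ultimately have eq: "real (card (verts G - {r} - ?V)) =
        real (card (verts G) - 1) * step_cost G r X (Suc i)"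
      using card unfolding step_cost_def lessThan_Suc_atMost by (simp add: of_nat_diff field_simps)
    show ?thesis
      using True by (simp only: if_True ennreal_of_nat_eq_real_of_nat eq ennreal_mult'[OF of_nat_0_le_iff])
  next
    case False
    \<comment> \<open>Beyond the cover time every vertex has been visited by time \<open>i\<close>,
      so the count is \<open>0\<close> as well.\<close>
    then obtain t where "verts G \<subseteq> (!!) X ` {..t}" "t \<le> i"
      unfolding cover_time_def by (auto simp: le_Inf_iff not_le less_Suc_eq_le)
    then have "verts G - {r} - ?V = {}" by force
    with False show ?thesis by (simp only: card.empty) simp
  qed
  finally show ?thesis ..
qed

text \<open>Nonnegativity lets the expectation pass through the series; for each pair the
  probabilities sum to a Green function, whose convergence in the reals gives finiteness.\<close>

lemma Cover_Cost_eq: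
  assumes sc: "strongly_connected G" and r: "r \<in> verts G" and card: "card (verts G) \<ge> 2"
  shows "Cover_Cost G r =
    ennreal (\<Sum>y\<in>verts G - {r}. \<Sum>x\<in>verts G - {y}.
      visits_before G r x y / hit_before_return G x y)"
proof -
  interpret prob_space "srw G r" by (rule prob_space_srw) fact
  let ?E = "\<lambda>y x i. {X \<in> space (srw G r). (\<forall>s\<le>i. X !! s \<noteq> y) \<and> X !! i = x}"
  let ?c = "\<lambda>X i. if 1 \<le> i \<and> enat i \<le> cover_time G X then ennreal (step_cost G r X i) else 0"
  have E[measurable]: "?E y x i \<in> events" for y x i
    by (intro sets_srw_Collect) measurable
  have tour: "of_nat (card (verts G) - 1) * tour_cost G r X =
      (\<Sum>i. \<Sum>y\<in>verts G - {r}. \<Sum>x\<in>verts G - {y}. indicator (?E y x i) X)"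
    if "X \<in> space (srw G r)" for X
  proof -
    have "tour_cost G r X =
        (\<Sum>i. if enat (Suc i) \<le> cover_time G X then ennreal (step_cost G r X (Suc i)) else 0)"
      unfolding tour_cost_def Suc_eq_plus1 by (subst suminf_offset[of _ 1]) auto
    then show ?thesis
      using step_cost_eq[OF that[unfolded space_srw] r card]
      by (simp only: ennreal_suminf_cmult[symmetric])
  qed
  have nonneg: "0 \<le> visits_before G r x y / hit_before_return G x y" for x y
    by (simp add: visits_before_def hit_before_return_def)
  let ?n = "of_nat (card (verts G) - 1) :: ennreal"
  \<comment> \<open>Measurability by division: \<open>?n\<close> is nonzero and finite, so the tour
    cost is a measurable series divided by \<open>?n\<close>.\<close>
  have "tour_cost G r X = (\<Sum>i. \<Sum>y\<in>verts G - {r}. \<Sum>x\<in>verts G - {y}. indicator (?E y x i) X) / ?n"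
    if "X \<in> space (srw G r)" for X
    unfolding tour[OF that, symmetric] mult.commute[of ?n]
    using card by (intro ennreal_mult_divide_eq[symmetric]) auto
  then have meas: "tour_cost G r \<in> borel_measurable (srw G r)"
    by (subst measurable_cong) auto
  have "Cover_Cost G r = (\<integral>\<^sup>+X. of_nat (card (verts G) - 1) * tour_cost G r X \<partial>srw G r)"
    unfolding Cover_Cost_def cover_cost_def by (simp add: nn_integral_cmult meas)
  also have "\<dots> = (\<integral>\<^sup>+X. (\<Sum>i. \<Sum>y\<in>verts G - {r}. \<Sum>x\<in>verts G - {y}. indicator (?E y x i) X) \<partial>srw G r)"
    by (intro nn_integral_cong tour)
  also have "\<dots> = (\<Sum>i. \<Sum>y\<in>verts G - {r}. \<Sum>x\<in>verts G - {y}. emeasure (srw G r) (?E y x i))"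
    by (simp add: nn_integral_suminf nn_integral_sum)
  also have "\<dots> = (\<Sum>i. ennreal (\<Sum>y\<in>verts G - {r}. \<Sum>x\<in>verts G - {y}. prob (?E y x i)))"
    by (simp add: emeasure_eq_measure sum_nonneg)
  also have "\<dots> = ennreal (\<Sum>y\<in>verts G - {r}. \<Sum>x\<in>verts G - {y}.
      visits_before G r x y / hit_before_return G x y)"
    using sums_Green_function[OF sc r]
    by (intro suminf_ennreal_eq sums_sum) (auto intro!: sum_nonneg)
  finally show ?thesis .
qed

end

theorem theorem1:
  fixes G :: "('a, 'b) pre_digraph" and r :: 'a
  assumes "Digraph.graph G" and "Digraph_Component.connected G"
    and "card (verts G) \<ge> 2" and "r \<in> verts G"
  shows "Cover_Cost G r =
    ennreal (\<Sum>(x, y) \<in> {(x, y). x \<in> verts G \<and> y \<in> verts G \<and> x \<noteq> y}.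
      visits_before G r x y / hit_before_return G x y)"
proof -
  interpret graph G by fact
  interpret random_walk_graph G by (rule connected_graph_random_walk) fact+
  let ?f = "\<lambda>x y. visits_before G r x y / hit_before_return G x y"
  have "strongly_connected G"
    using assms(2) sym_arcs by (intro symmetric_connected_imp_strongly_connected)
  then have "Cover_Cost G r = ennreal (\<Sum>y\<in>verts G - {r}. \<Sum>x\<in>verts G - {y}. ?f x y)"
    using assms by (intro Cover_Cost_eq)
  \<comment> \<open>The added terms with \<open>y = r\<close> vanish, as the walk from
    \<open>r\<close> visits no other \<open>x\<close> before \<open>r\<close>.\<close>
  also have "(\<Sum>y\<in>verts G - {r}. \<Sum>x\<in>verts G - {y}. ?f x y) =
      (\<Sum>y\<in>verts G. \<Sum>x\<in>verts G - {y}. ?f x y)"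
    using assms(4) visits_before_start(2)[OF assms(4)]
    by (intro sum.mono_neutral_left) (auto intro!: sum.neutral)
  also have "\<dots> = (\<Sum>(y, x)\<in>(SIGMA y:verts G. verts G - {y}). ?f x y)"
    by (simp add: sum.Sigma)
  also have "\<dots> = (\<Sum>(x, y) \<in> {(x, y). x \<in> verts G \<and> y \<in> verts G \<and> x \<noteq> y}. ?f x y)"
    by (rule sum.reindex_bij_witness[of _ prod.swap prod.swap]) auto
  finally show ?thesis .
qed

end
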